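(* Let $m\geq 3$ be an integer and let $\mathcal{L}$ be an $m$-homogeneous supersolvable line arrangement in the complex projective plane $\mathbb{P}^2_{\mathbb{C}}$. Let $t_m$ denote the number of crossing points of $\mathcal{L}$ of multiplicity $m$. Then $1\leq t_m\leq 4$.
   Context: A line arrangement is a finite set $\mathcal{L}=\{L_1,\dots,L_s\}$ of $s>1$ distinct lines in the projective plane over a field. A crossing point of $\mathcal{L}$ is a point where two or more lines of $\mathcal{L}$ meet; its multiplicity is the number of lines of $\mathcal{L}$ containing it. A modular point of $\mathcal{L}$ is a crossing point $p$ such that for every other crossing point $q\neq p$ of $\mathcal{L}$, the line through $p$ and $q$ belongs to $\mathcal{L}$. $\mathcal{L}$ is supersolvable if it has at least one modular point. A supersolvable line arrangement is $m$-homogeneous if all of its modular points have the same multiplicity $m$. *)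

theory Defs
  imports "HOL-Analysis.Analysis"
begin

text \<open>
  The projective plane over a field \<open>'a\<close>: points and lines are the linear subspaces of
  \<open>'a ^ 3\<close> of dimension 1 and 2, taken with respect to the scalars \<open>'a\<close> (hence \<open>vec.subspace\<close>
  and \<open>vec.dim\<close>, not the real versions), and incidence is inclusion of subspaces.
\<close>

definition proj_point :: "('a::field ^ 3) set \<Rightarrow> bool" where
  "proj_point p \<longleftrightarrow> vec.subspace p \<and> vec.dim p = 1"

definition proj_line :: "('a::field ^ 3) set \<Rightarrow> bool" where
  "proj_line l \<longleftrightarrow> vec.subspace l \<and> vec.dim l = 2"

definition line_through :: "('a::field ^ 3) set \<Rightarrow> ('a ^ 3) set \<Rightarrow> ('a ^ 3) set" where
  "line_through p q = vec.span (p \<union> q)"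

definition line_arrangement :: "('a::field ^ 3) set set \<Rightarrow> bool" where
  "line_arrangement \<L> \<longleftrightarrow> finite \<L> \<and> card \<L> > 1 \<and> (\<forall>l\<in>\<L>. proj_line l)"

definition multiplicity_at :: "('a::field ^ 3) set set \<Rightarrow> ('a ^ 3) set \<Rightarrow> nat" where
  "multiplicity_at \<L> p = card {l \<in> \<L>. p \<subseteq> l}"

definition crossing_point :: "('a::field ^ 3) set set \<Rightarrow> ('a ^ 3) set \<Rightarrow> bool" where
  "crossing_point \<L> p \<longleftrightarrow> proj_point p \<and> multiplicity_at \<L> p \<ge> 2"

definition modular_point :: "('a::field ^ 3) set set \<Rightarrow> ('a ^ 3) set \<Rightarrow> bool" where
  "modular_point \<L> p \<longleftrightarrow> crossing_point \<L> p \<and>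
     (\<forall>q. crossing_point \<L> q \<and> q \<noteq> p \<longrightarrow> line_through p q \<in> \<L>)"

definition supersolvable :: "('a::field ^ 3) set set \<Rightarrow> bool" where
  "supersolvable \<L> \<longleftrightarrow> line_arrangement \<L> \<and> (\<exists>p. modular_point \<L> p)"

definition homogeneous_supersolvable :: "nat \<Rightarrow> ('a::field ^ 3) set set \<Rightarrow> bool" where
  "homogeneous_supersolvable m \<L> \<longleftrightarrow> supersolvable \<L> \<and>
     (\<forall>p. modular_point \<L> p \<longrightarrow> multiplicity_at \<L> p = m)"

definition num_crossing_points :: "('a::field ^ 3) set set \<Rightarrow> nat \<Rightarrow> nat" where
  "num_crossing_points \<L> k = card {p. crossing_point \<L> p \<and> multiplicity_at \<L> p = k}"

end

theory Submission
  imports Defs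
begin

text \<open>
  A crossing point of the same multiplicity \<open>m\<close> as a modular point is itself modular, so it suffices
  to exclude five modular points of multiplicity \<open>m\<close>.

  If three of them were collinear, the lines of \<open>\<L>\<close> through them, in affine coordinates with the
  common line at infinity, would be given by sets \<open>A\<close>, \<open>B\<close>, \<open>C\<close> of \<open>m - 1\<close> scalars with
  \<open>b - a \<in> C\<close> for all \<open>a \<in> A\<close>, \<open>b \<in> B\<close>. Summing over \<open>A\<close> shows that \<open>(m - 1) b\<close> does not depend
  on \<open>b\<close>, so \<open>B\<close> has only one element in characteristic 0, contradicting \<open>m \<ge> 3\<close>.

  For a triangle of modular points the same argument with products in place of sums shows that the
  \<open>m - 2\<close> lines through a vertex other than the two sides have slopes with the same \<open>(m - 2)\<close>-th
  power, hence of equal modulus. Normalize four of the points to the unit vectors and \<open>(1, 1, 1)\<close>, and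
  let \<open>(x, y, z)\<close> be the fifth. Applied to several triangles, this yields
  \<open>|x| = |y| = |z| = |x - y| = |x - z| = |y - z|\<close>, so \<open>0, x, y, z\<close> would be four points of the plane at
  equal mutual distances.
\<close>

section \<open>Points, lines and incidence in the projective plane\<close>

lemma proj_point_iff: "proj_point p \<longleftrightarrow> (\<exists>v. v \<noteq> 0 \<and> p = vec.span {v})"
proof
  assume p: "proj_point p"
  then have "vec.subspace p" "vec.dim p = 1" by (auto simp: proj_point_def)
  moreover obtain B where "B \<subseteq> p" "vec.independent B" "p \<subseteq> vec.span B" "card B = vec.dim p"
    using vec.basis_exists[of p] by blast
  ultimately obtain v where "B = {v}" "vec.span B = p" "vec.independent B"
    by (metis card_1_singletonE vec.span_subspace)
  then show "\<exists>v. v \<noteq> 0 \<and> p = vec.span {v}"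
    by (metis singletonI vec.dependent_zero)
next
  assume "\<exists>v. v \<noteq> 0 \<and> p = vec.span {v}"
  then obtain v where v: "v \<noteq> 0" "p = vec.span {v}" by blast
  then have "vec.dim p = 1"
    using vec.dim_span_eq_card_independent[of "{v}"] by (simp add: vec.dependent_single)
  with v show "proj_point p" by (simp add: proj_point_def)
qed

lemma independent_pair:
  assumes "x \<noteq> 0" "y \<notin> vec.span {x}"
  shows "vec.independent {x, y}" "card {x, y} = 2"
proof -
  show "vec.independent {x, y}"
    using vec.independent_insertI[of y "{x}"] assms by (simp add: insert_commute)
  show "card {x, y} = 2"
    using assms vec.span_base[of x "{x}"] by (cases "x = y") auto
qed

lemma proj_line_eq_span:
  assumes "proj_line l" "x \<in> l" "y \<in> l" "x \<noteq> 0" "y \<notin> vec.span {x}"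
  shows "l = vec.span {x, y}"
proof -
  have "l \<subseteq> vec.span {x, y}"
    using assms independent_pair[of x y] vec.card_ge_dim_independent[of "{x,y}" l]
    by (auto simp: proj_line_def)
  moreover have "vec.span {x, y} \<subseteq> l"
    using assms by (intro vec.span_minimal) (auto simp: proj_line_def)
  ultimately show ?thesis by blast
qed

lemma proj_lines_meet_span:
  assumes "proj_line l" "proj_line l'" "l \<noteq> l'" "x \<noteq> 0" "x \<in> l" "x \<in> l'" "y \<in> l" "y \<in> l'"
  shows "y \<in> vec.span {x}"
proof (rule ccontr)
  assume "y \<notin> vec.span {x}"
  from proj_line_eq_span[OF assms(1,5,7,4) this] proj_line_eq_span[OF assms(2,6,8,4) this] assms(3)
  show False by simp
qed

text \<open>A vector outside a plane spans, together with that plane, the whole 3-dimensional space,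
  so \<open>v\<close> can be moved along \<open>w\<close> into \<open>l\<close>. Later this finds
  the slope of a line through a vertex.\<close>

lemma proj_line_complement:
  fixes w :: "'a::field ^ 3"
  assumes "proj_line l" "w \<notin> l"
  obtains a where "v + a *s w \<in> l"
proof -
  have l: "vec.subspace l" "vec.dim l = 2" using assms by (auto simp: proj_line_def)
  have w: "w \<notin> vec.span l" using assms l by (metis vec.span_eq_iff)
  have "vec.dim (insert w l) = 3" using l w by (simp add: vec.dim_insert)
  then have "vec.span (insert w l) = UNIV"
    by (simp add: vec.dim_eq_full[symmetric] vec.dimension_def card_cart_basis)
  then have "v \<in> vec.span (insert w l)" by simp
  then obtain k where "v - k *s w \<in> vec.span l"
    by (auto simp: vec.span_insert)
  then show ?thesis
    using that[of "-k"] l by (metis vec.scale_minus_left diff_conv_add_uminus vec.span_eq_iff)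
qed

text \<open>For a basis \<open>a\<close>, \<open>b\<close> of \<open>l\<close>, either
  \<open>a\<close> lies in \<open>l'\<close> or \<open>b\<close> can be moved along \<open>a\<close>
  into \<open>l'\<close>. The moved vector stays in \<open>l\<close> and is nonzero by
  independence.\<close>

lemma proj_lines_meet:
  assumes "proj_line l" "proj_line l'"
  obtains x where "x \<noteq> 0" "x \<in> l" "x \<in> l'"
proof -
  obtain B where B: "B \<subseteq> l" "vec.independent B" "l \<subseteq> vec.span B" "card B = vec.dim l"
    using vec.basis_exists[of l] by blast
  then have "card B = 2" using assms by (simp add: proj_line_def)
  then obtain a b where ab: "B = {a, b}" "a \<noteq> b" by (meson card_2_iff)
  have ne: "a \<noteq> 0" using B ab vec.dependent_zero by blast
  show ?thesis
  proof (cases "a \<in> l'")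
    case True
    then show ?thesis using that B ab ne by blast
  next
    case False
    then obtain k where k: "b + k *s a \<in> l'" using proj_line_complement assms by metis
    have "b + k *s a \<in> l"
      using B ab assms by (auto simp: proj_line_def intro!: vec.subspace_add vec.subspace_scale)
    moreover have "b + k *s a \<noteq> 0"
    proof
      assume "b + k *s a = 0"
      then have "b = (-k) *s a" by (metis add_eq_0_iff2 vec.scale_minus_left)
      then have "b \<in> vec.span {a}" by (metis vec.span_base vec.span_scale singletonI)
      moreover have "b \<notin> vec.span {a}"
        using B(2) ab vec.independent_insert[of b "{a}"] by (simp add: insert_commute)
      ultimately show False by blast
    qed
    ultimately show ?thesis using that k by blast
  qed
qed

lemma span_singleton_subset_iff:
  "proj_line l \<Longrightarrow> vec.span {v} \<subseteq> l \<longleftrightarrow> v \<in> l"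
  unfolding proj_line_def by (meson empty_subsetI insert_subset vec.span_base vec.span_minimal singletonI subsetD)

lemma span_singleton_scale:
  "(k::'a::field) \<noteq> 0 \<Longrightarrow> vec.span {k *s v} = vec.span {v}"
  by (metis vec.span_image_scale[of "{v}" "\<lambda>_. k"] finite.emptyI finite_insert image_empty image_insert)

lemma mem_span_singleton_swap:
  assumes "y \<noteq> 0" "y \<in> vec.span {x}"
  shows "x \<in> vec.span {y}"
proof -
  obtain k where k: "y = k *s x" using assms(2) by (auto simp: vec.span_singleton)
  with assms show ?thesis using span_singleton_scale[of k x]
    by (metis vec.scale_eq_0_iff vec.span_base singletonI)
qed

lemma span_singleton_eq_iff:
  assumes "x \<noteq> 0" "y \<noteq> 0"
  shows "vec.span {x} = vec.span {y} \<longleftrightarrow> y \<in> vec.span {x}"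
proof
  show "y \<in> vec.span {x}" if "vec.span {x} = vec.span {y}"
    using vec.span_base[of y "{y}"] that by blast
next
  assume y: "y \<in> vec.span {x}"
  have "x \<in> vec.span {y}" by (rule mem_span_singleton_swap[OF assms(2) y])
  with y show "vec.span {x} = vec.span {y}" by (simp add: vec.span_eq)
qed

section \<open>Crossing points and modular points in terms of spanning vectors\<close>

lemma line_through_span: "line_through (vec.span {u}) (vec.span {v}) = vec.span {u, v}"
proof
  have "vec.span {u} \<subseteq> vec.span {u, v}" "vec.span {v} \<subseteq> vec.span {u, v}"
    by (auto intro!: vec.span_mono)
  then show "line_through (vec.span {u}) (vec.span {v}) \<subseteq> vec.span {u, v}"
    unfolding line_through_def by (intro vec.span_minimal) auto
  show "vec.span {u, v} \<subseteq> line_through (vec.span {u}) (vec.span {v})"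
    unfolding line_through_def by (rule vec.span_mono) (auto intro: vec.span_base)
qed

lemma multiplicity_at_span:
  assumes "line_arrangement L"
  shows "multiplicity_at L (vec.span {v}) = card {l \<in> L. v \<in> l}"
proof -
  have "vec.span {v} \<subseteq> l \<longleftrightarrow> v \<in> l" if "l \<in> L" for l
    using assms that span_singleton_subset_iff[of l v] by (simp add: line_arrangement_def)
  then have "{l \<in> L. vec.span {v} \<subseteq> l} = {l \<in> L. v \<in> l}"
    by (intro Collect_cong conj_cong refl)
  then show ?thesis by (simp add: multiplicity_at_def)
qed

lemma crossing_point_span:
  assumes "line_arrangement L"
  shows "crossing_point L (vec.span {v}) \<longleftrightarrow>
    v \<noteq> 0 \<and> (\<exists>l\<in>L. \<exists>l'\<in>L. l \<noteq> l' \<and> v \<in> l \<and> v \<in> l')"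
proof -
  have fin: "finite {l \<in> L. v \<in> l}" using assms by (simp add: line_arrangement_def)
  have "card {l \<in> L. v \<in> l} \<ge> 2 \<longleftrightarrow> (\<exists>l\<in>L. \<exists>l'\<in>L. l \<noteq> l' \<and> v \<in> l \<and> v \<in> l')"
    using card_le_Suc0_iff_eq[OF fin] by (auto simp: not_less_eq_eq[symmetric] numeral_2_eq_2)
  moreover have "proj_point (vec.span {v}) \<longleftrightarrow> v \<noteq> 0"
    unfolding proj_point_iff
    by (metis vec.span_base singletonI vec.span_empty vec.span_insert_0 singletonD)
  ultimately show ?thesis
    unfolding crossing_point_def multiplicity_at_span[OF assms] by simp
qed

text \<open>The zero vector lies in every span, so \<open>x \<notin> vec.span {u}\<close> expresses
  at once that \<open>x\<close> represents a point and that this point is not the one of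
  \<open>u\<close>.\<close>

lemma modular_point_span:
  assumes "line_arrangement L"
  shows "modular_point L (vec.span {u}) \<longleftrightarrow> crossing_point L (vec.span {u}) \<and>
    (\<forall>x l l'. l \<in> L \<and> l' \<in> L \<and> l \<noteq> l' \<and> x \<in> l \<and> x \<in> l' \<and> x \<notin> vec.span {u}
       \<longrightarrow> vec.span {u, x} \<in> L)"
proof (cases "crossing_point L (vec.span {u})")
  case True
  then have u: "u \<noteq> 0" using crossing_point_span[OF assms] by blast
  have "(\<forall>q. crossing_point L q \<and> q \<noteq> vec.span {u} \<longrightarrow> line_through (vec.span {u}) q \<in> L) \<longleftrightarrow>
    (\<forall>x. crossing_point L (vec.span {x}) \<and> vec.span {x} \<noteq> vec.span {u} \<longrightarrow> vec.span {u, x} \<in> L)"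
    by (metis line_through_span crossing_point_def proj_point_iff)
  also have "\<dots> \<longleftrightarrow> (\<forall>x l l'. l \<in> L \<and> l' \<in> L \<and> l \<noteq> l' \<and> x \<in> l \<and> x \<in> l' \<and> x \<notin> vec.span {u}
       \<longrightarrow> vec.span {u, x} \<in> L)"
    unfolding crossing_point_span[OF assms]
    by (metis span_singleton_eq_iff u vec.span_zero)
  finally show ?thesis using True by (simp add: modular_point_def)
next
  case False
  then show ?thesis by (simp add: modular_point_def)
qed

text \<open>A crossing point is the intersection of two lines of \<open>L\<close>, and there are
  finitely many pairs of lines.\<close>

lemma finite_crossing_points:
  assumes "line_arrangement L"
  shows "finite {p. crossing_point L p}"
proof (rule finite_subset)
  show "{p. crossing_point L p} \<subseteq> (\<lambda>(l, l'). l \<inter> l') ` (L \<times> L)"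
  proof
    fix p assume "p \<in> {p. crossing_point L p}"
    then have p: "crossing_point L p" by simp
    then obtain v where v: "v \<noteq> 0" "p = vec.span {v}"
      by (auto simp: crossing_point_def proj_point_iff)
    with p obtain l l' where l: "l \<in> L" "l' \<in> L" "l \<noteq> l'" "v \<in> l" "v \<in> l'"
      using crossing_point_span[OF assms] by blast
    then have pl: "proj_line l" "proj_line l'" using assms by (auto simp: line_arrangement_def)
    have "p = l \<inter> l'"
      using proj_lines_meet_span[OF pl] l v span_singleton_subset_iff pl by blast
    with l show "p \<in> (\<lambda>(l, l'). l \<inter> l') ` (L \<times> L)" by blast
  qed
  show "finite ((\<lambda>(l, l'). l \<inter> l') ` (L \<times> L))"
    using assms by (simp add: line_arrangement_def)
qed

text \<open>
  If a crossing point \<open>x\<close> were not joined to \<open>v\<close> by a line of \<open>L\<close>, a second line \<open>h\<close> through \<open>x\<close>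
  would meet the lines through \<open>v\<close> other than \<open>uv\<close> in points lying on different lines through \<open>u\<close>.
  By equality of the multiplicities these are all the lines through \<open>u\<close> other than \<open>uv\<close>; one of
  them is \<open>ux\<close>, so \<open>x\<close> lies on a line through \<open>v\<close> after all.
\<close>

lemma modular_point_if_same_multiplicity:
  assumes L: "line_arrangement L"
    and mod_u: "modular_point L (vec.span {u})"
    and cross_v: "crossing_point L (vec.span {v})"
    and mult: "multiplicity_at L (vec.span {v}) = multiplicity_at L (vec.span {u})"
  shows "modular_point L (vec.span {v})"
proof (cases "v \<in> vec.span {u}")
  case True
  have "u \<noteq> 0" "v \<noteq> 0"
    using mod_u cross_v crossing_point_span[OF L] by (auto simp: modular_point_def)
  then show ?thesis using True mod_u span_singleton_eq_iff[of u v] by simp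
next
  case False
  have fin: "finite L" and line: "\<And>l. l \<in> L \<Longrightarrow> proj_line l"
    using L by (auto simp: line_arrangement_def)
  have u0: "u \<noteq> 0" and v0: "v \<noteq> 0"
    using mod_u cross_v crossing_point_span[OF L] by (auto simp: modular_point_def)
  have mod: "vec.span {u, x} \<in> L"
    if "l \<in> L" "l' \<in> L" "l \<noteq> l'" "x \<in> l" "x \<in> l'" "x \<notin> vec.span {u}" for x l l'
    using mod_u that unfolding modular_point_span[OF L] by blast
  define M where "M = vec.span {u, v}"
  obtain k k' where k: "k \<in> L" "k' \<in> L" "k \<noteq> k'" "v \<in> k" "v \<in> k'"
    using cross_v crossing_point_span[OF L] by blast
  have M: "M \<in> L" unfolding M_def using mod[OF k False] .
  have uM: "u \<in> M" and vM: "v \<in> M" by (auto simp: M_def vec.span_base)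
  have "vec.span {v, x} \<in> L"
    if x: "l \<in> L" "l' \<in> L" "l \<noteq> l'" "x \<in> l" "x \<in> l'" "x \<notin> vec.span {v}" for x l l'
  proof (rule ccontr)
    assume not: "vec.span {v, x} \<notin> L"
    have not_both: "\<not> (v \<in> j \<and> x \<in> j)" if "j \<in> L" for j
      using proj_line_eq_span[OF line[OF that] _ _ v0 x(6)] not that by auto
    have xM: "x \<notin> M" using not_both[OF M] vM by blast
    have xu: "x \<notin> vec.span {u}"
      using xM vec.span_mono[of "{u}" "{u, v}"] by (auto simp: M_def)
    have ux: "vec.span {u, x} \<in> L" using mod[OF x(1-5) xu] .
    \<comment> \<open>At most one of the two lines \<open>l\<close>, \<open>l'\<close> through
      \<open>x\<close> can pass through \<open>u\<close>, since such a line equals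
      \<open>ux\<close>; the other one serves as \<open>h\<close>.\<close>
    obtain h where h: "h \<in> L" "x \<in> h" "u \<notin> h"
    proof -
      have "\<not> (u \<in> l \<and> u \<in> l')"
        using proj_line_eq_span[OF line[OF x(1)] _ x(4) u0 xu]
          proj_line_eq_span[OF line[OF x(2)] _ x(5) u0 xu] x(3) by auto
      then show ?thesis using that x by blast
    qed
    define Lv where "Lv = {l \<in> L. v \<in> l} - {M}"
    define Lu where "Lu = {l \<in> L. u \<in> l} - {M}"
    have "\<exists>y. y \<noteq> 0 \<and> y \<in> l \<and> y \<in> h" if "l \<in> Lv" for l
    proof -
      have "proj_line l" using that line by (simp add: Lv_def)
      then show ?thesis using proj_lines_meet[of l h] line[OF h(1)] by blast
    qed
    then obtain y where y: "\<And>l. l \<in> Lv \<Longrightarrow> y l \<noteq> 0 \<and> y l \<in> l \<and> y l \<in> h" by metis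
    have vh: "v \<notin> h" using not_both[OF h(1)] h(2) by blast
    have scale: "a \<in> j" if "a \<in> vec.span {b}" "b \<in> j" "j \<in> L" for a b j
      using span_singleton_subset_iff[OF line[OF that(3)], of b] that by blast
    have y_not_v: "y l \<notin> vec.span {v}" if "l \<in> Lv" for l
      using mem_span_singleton_swap[of "y l" v] scale[of v "y l" h] y[OF that] vh h by blast
    have y_not_u: "y l \<notin> vec.span {u}" if "l \<in> Lv" for l
      using mem_span_singleton_swap[of "y l" u] scale[of u "y l" h] y[OF that] h by blast
    define f where "f l = vec.span {u, y l}" for l
    have u_f: "u \<in> f l" and y_f: "y l \<in> f l" for l by (auto simp: f_def vec.span_base)
    have f_L: "f l \<in> L" if "l \<in> Lv" for l
    proof -
      have "l \<in> L" "l \<noteq> h" using that vh by (auto simp: Lv_def)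
      then show ?thesis unfolding f_def
        using mod[of l h "y l"] h y[OF that] y_not_u[OF that] by blast
    qed
    have y_mem: "z \<in> vec.span {y l}" if "l \<in> Lv" "z \<in> f l" "z \<in> h" for l z
      using proj_lines_meet_span[of "f l" h "y l" z] line f_L[OF that(1)] h u_f y_f y[OF that(1)] that
      by blast
    \<comment> \<open>The line \<open>f l\<close> determines the point of \<open>y l\<close> as its
      intersection with \<open>h\<close>, and that point determines \<open>l\<close> as the line
      joining it to \<open>v\<close>.\<close>
    have "inj_on f Lv"
    proof
      fix l l' assume l: "l \<in> Lv" "l' \<in> Lv" "f l = f l'"
      have "y l' \<in> vec.span {y l}" using y_mem[OF l(1), of "y l'"] l(3) y_f[of l'] y[OF l(2)] by auto
      then have "y l' \<in> l" using scale[of "y l'" "y l" l] y[OF l(1)] l by (auto simp: Lv_def)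
      then show "l = l'"
        using proj_lines_meet_span[of l l' v "y l'"] line l y[OF l(2)] y_not_v[OF l(2)] v0
        by (auto simp: Lv_def)
    qed
    moreover have "f l \<in> Lu" if "l \<in> Lv" for l
    proof -
      have "f l \<noteq> M"
      proof
        assume "f l = M"
        then have "y l \<in> M" using y_f[of l] by simp
        then show False
          using proj_lines_meet_span[of l M v "y l"] line M vM that v0 y[OF that] y_not_v[OF that]
          by (auto simp: Lv_def)
      qed
      then show ?thesis using f_L[OF that] u_f by (auto simp: Lu_def)
    qed
    then have "f ` Lv \<subseteq> Lu" by blast
    \<comment> \<open>The common line \<open>M\<close> is removed from both pencils, so equal
      multiplicities leave equally many lines and the injection \<open>f\<close> is onto.\<close>
    moreover have "card Lv = card Lu"
      using mult M uM vM fin unfolding multiplicity_at_span[OF L] Lv_def Lu_def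
      by (simp add: card_Diff_singleton)
    moreover have "finite Lu" using fin by (simp add: Lu_def)
    ultimately have "f ` Lv = Lu" by (metis card_image card_subset_eq)
    moreover have "vec.span {u, x} \<in> Lu"
    proof -
      have "x \<in> vec.span {u, x}" "u \<in> vec.span {u, x}" by (auto simp: vec.span_base)
      then show ?thesis using ux xM by (auto simp: Lu_def)
    qed
    ultimately obtain l where l: "l \<in> Lv" "f l = vec.span {u, x}" by auto
    have "x \<in> f l" using l(2) by (simp add: vec.span_base)
    then have "x \<in> l" using y_mem[OF l(1) _ h(2)] scale[of x "y l" l] y[OF l(1)] l by (auto simp: Lv_def)
    then show False using not_both[of l] l(1) by (auto simp: Lv_def)
  qed
  then show ?thesis using cross_v unfolding modular_point_span[OF L] by blast
qed

section \<open>Coordinates with respect to a triangle\<close>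

lemma mem_span_pair: "x \<in> vec.span {u, y} \<longleftrightarrow> (\<exists>s t. x = s *s u + t *s y)"
proof -
  have "x \<in> vec.span {u, y} \<longleftrightarrow> (\<exists>s t. x - s *s u = t *s y)"
    by (auto simp: vec.span_insert[of u "{y}"] vec.span_singleton)
  then show ?thesis by (simp add: diff_eq_eq add.commute)
qed

text \<open>Brings a line through \<open>u\<close> into the normal form in which its slope can be
  read off.\<close>

lemma span_pair_replace:
  assumes "k \<noteq> 0"
  shows "vec.span {u, k *s y + s *s u} = vec.span {u, y}"
proof
  have "k *s y + s *s u \<in> vec.span {u, y}" "u \<in> vec.span {u, y}"
    unfolding mem_span_pair by (metis add.commute, metis add.right_neutral vec.scale_one vec.scale_zero_left)
  then show "vec.span {u, k *s y + s *s u} \<subseteq> vec.span {u, y}"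
    by (intro vec.span_minimal) auto
  have "y = (- s / k) *s u + (1 / k) *s (k *s y + s *s u)"
    using assms by (simp add: vec_eq_iff field_simps)
  then have "y \<in> vec.span {u, k *s y + s *s u}" unfolding mem_span_pair by blast
  then show "vec.span {u, y} \<subseteq> vec.span {u, k *s y + s *s u}"
    by (intro vec.span_minimal) (auto intro: vec.span_base)
qed

text \<open>This is linear independence of the family rather than of the set, so coinciding vectors
  are excluded and coefficients can be compared directly.\<close>

definition noncollinear :: "'a::field ^ 3 \<Rightarrow> 'a ^ 3 \<Rightarrow> 'a ^ 3 \<Rightarrow> bool" where
  "noncollinear u v w \<longleftrightarrow>
    (\<forall>a b c. a *s u + b *s v + c *s w = 0 \<longrightarrow> a = 0 \<and> b = 0 \<and> c = 0)"

lemma noncollinear_swap12: "noncollinear u v w \<Longrightarrow> noncollinear v u w"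
  unfolding noncollinear_def by (metis add.commute)

lemma noncollinear_swap23:
  assumes "noncollinear u v w"
  shows "noncollinear u w v"
  unfolding noncollinear_def
proof (intro allI impI)
  fix a b c assume "a *s u + b *s w + c *s v = 0"
  then have "a *s u + c *s v + b *s w = 0" by (simp add: ac_simps)
  then show "a = 0 \<and> b = 0 \<and> c = 0" using assms unfolding noncollinear_def by blast
qed

lemma noncollinear_rotate: "noncollinear u v w \<Longrightarrow> noncollinear v w u"
  by (rule noncollinear_swap23[OF noncollinear_swap12])

lemma noncollinear_coords_eq:
  assumes "noncollinear u v w"
    and "x1 *s u + x2 *s v + x3 *s w = y1 *s u + y2 *s v + y3 *s w"
  shows "x1 = y1" "x2 = y2" "x3 = y3"
proof -
  have "(x1 - y1) *s u + (x2 - y2) *s v + (x3 - y3) *s w = 0"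
    using assms(2) by (simp add: vec_eq_iff algebra_simps)
  then have "x1 - y1 = 0 \<and> x2 - y2 = 0 \<and> x3 - y3 = 0"
    using assms(1) unfolding noncollinear_def by blast
  then show "x1 = y1" "x2 = y2" "x3 = y3" by simp_all
qed

text \<open>In the coordinates of the triangle, the line of slope \<open>a\<close> through
  \<open>u\<close> has the equation \<open>x3 = a * x2\<close>; incidence becomes a condition on
  scalars.\<close>

lemma noncollinear_mem_span:
  assumes "noncollinear u v w"
  shows "x1 *s u + x2 *s v + x3 *s w \<in> vec.span {u, v + a *s w} \<longleftrightarrow> x3 = a * x2"
proof
  assume "x1 *s u + x2 *s v + x3 *s w \<in> vec.span {u, v + a *s w}"
  then obtain s t where "x1 *s u + x2 *s v + x3 *s w = s *s u + t *s (v + a *s w)"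
    unfolding mem_span_pair by blast
  then have "x1 *s u + x2 *s v + x3 *s w = s *s u + t *s v + (t * a) *s w"
    by (simp add: vec_eq_iff algebra_simps)
  from noncollinear_coords_eq[OF assms this] show "x3 = a * x2" by simp
next
  assume "x3 = a * x2"
  then have "x1 *s u + x2 *s v + x3 *s w = x1 *s u + x2 *s (v + a *s w)"
    by (simp add: vec_eq_iff algebra_simps)
  then show "x1 *s u + x2 *s v + x3 *s w \<in> vec.span {u, v + a *s w}"
    unfolding mem_span_pair by blast
qed

lemma noncollinear_nonzero: "noncollinear u v w \<Longrightarrow> u \<noteq> 0"
  unfolding noncollinear_def
  by (metis add_0 vec.scale_zero_left vec.scale_zero_right zero_neq_one)

lemma noncollinear_notin_span:
  assumes "noncollinear u v w" and "x2 \<noteq> 0 \<or> x3 \<noteq> 0"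
  shows "x1 *s u + x2 *s v + x3 *s w \<notin> vec.span {u}"
proof
  assume "x1 *s u + x2 *s v + x3 *s w \<in> vec.span {u}"
  then obtain k where "x1 *s u + x2 *s v + x3 *s w = k *s u + 0 *s v + 0 *s w"
    by (auto simp: vec.span_singleton)
  from noncollinear_coords_eq[OF assms(1) this] assms(2) show False by simp
qed

lemma noncollinearI:
  assumes "u \<noteq> 0" "v \<notin> vec.span {u}" "w \<notin> vec.span {u, v}"
  shows "noncollinear u v w"
  unfolding noncollinear_def
proof (intro allI impI)
  fix a b c assume eq: "a *s u + b *s v + c *s w = 0"
  have c: "c = 0"
  proof (rule ccontr)
    assume c: "c \<noteq> 0"
    have "w = (1 / c) *s (c *s w)" using c by (simp add: vec_eq_iff)
    also have "c *s w = (-a) *s u + (-b) *s v"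
      using eq by (simp add: vec_eq_iff algebra_simps) (metis add_eq_0_iff add.assoc)
    also have "(1 / c) *s \<dots> = (-a/c) *s u + (-b/c) *s v"
      by (simp add: vec_eq_iff algebra_simps)
    finally show False using assms(3) unfolding mem_span_pair by blast
  qed
  moreover have b: "b = 0"
  proof (rule ccontr)
    assume b: "b \<noteq> 0"
    have "v = (1 / b) *s (b *s v)" using b by (simp add: vec_eq_iff)
    also have "b *s v = (-a) *s u"
      using eq c by (simp add: vec_eq_iff) (metis add_eq_0_iff)
    also have "(1 / b) *s \<dots> = (-a/b) *s u" by (simp add: vec_eq_iff)
    finally show False using assms(2) by (metis vec.span_base vec.span_scale singletonI)
  qed
  ultimately show "a = 0 \<and> b = 0 \<and> c = 0" using eq assms(1) by simp
qed

lemma proj_line_span_pair: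
  assumes "x \<noteq> 0" "y \<notin> vec.span {x}"
  shows "proj_line (vec.span {x, y})"
  using vec.dim_span_eq_card_independent[OF independent_pair(1)[OF assms]]
    independent_pair(2)[OF assms] by (simp add: proj_line_def)

lemma noncollinear_coords:
  assumes "noncollinear u v w"
  obtains a b c where "x = a *s u + b *s v + c *s w"
proof -
  have u: "u \<noteq> 0" using noncollinear_nonzero[OF assms] .
  have v: "v \<notin> vec.span {u}" using noncollinear_notin_span[OF assms, of 1 0 0] by simp
  have "w \<notin> vec.span {u, v}" using noncollinear_mem_span[OF assms, of 0 0 1 0] by simp
  then obtain k where "x + k *s w \<in> vec.span {u, v}"
    using proj_line_complement[OF proj_line_span_pair[OF u v]] by metis
  then obtain s t where "x + k *s w = s *s u + t *s v" unfolding mem_span_pair by blast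
  then have "x = s *s u + t *s v + (-k) *s w"
    by (simp add: vec_eq_iff algebra_simps)
  then show ?thesis using that by blast
qed

section \<open>Slopes of the lines of an arrangement through a vertex\<close>

text \<open>
  For noncollinear \<open>u, v, w\<close> the slopes parametrize the lines of \<open>L\<close> through \<open>u\<close> other than \<open>uw\<close>;
  slope \<open>0\<close> is the line \<open>uv\<close>.
\<close>

definition slopes :: "('a::field ^ 3) set set \<Rightarrow> 'a ^ 3 \<Rightarrow> 'a ^ 3 \<Rightarrow> 'a ^ 3 \<Rightarrow> 'a set" where
  "slopes L u v w = {a. vec.span {u, v + a *s w} \<in> L}"

text \<open>A line through \<open>u\<close> that avoids \<open>w\<close> contains exactly one vector
  of the form \<open>v + a *s w\<close>. The subtracted 1 accounts for the line \<open>uw\<close>,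
  which has no slope.\<close>

lemma slopes_finite_card:
  assumes L: "line_arrangement L" and nc: "noncollinear u v w" and uw: "vec.span {u, w} \<in> L"
  shows "finite (slopes L u v w)" "card (slopes L u v w) = multiplicity_at L (vec.span {u}) - 1"
proof -
  have fin: "finite L" and line: "\<And>l. l \<in> L \<Longrightarrow> proj_line l"
    using L by (auto simp: line_arrangement_def)
  define f where "f a = vec.span {u, v + a *s w}" for a
  define R where "R = {l \<in> L. u \<in> l} - {vec.span {u, w}}"
  have finR: "finite R" using fin by (simp add: R_def)
  have u0: "u \<noteq> 0" using noncollinear_nonzero[OF nc] .
  have wu: "w \<notin> vec.span {u}" using noncollinear_notin_span[OF nc, of 0 1 0] by simp
  have "inj f"
  proof
    fix a b assume "f a = f b"
    moreover have "v + a *s w \<in> f a" unfolding f_def by (rule vec.span_base) simp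
    ultimately have "v + a *s w \<in> vec.span {u, v + b *s w}" unfolding f_def by blast
    then show "a = b" using noncollinear_mem_span[OF nc, of 0 1 a b] by simp
  qed
  then have inj: "inj_on f (slopes L u v w)" by (rule inj_on_subset) simp
  have im: "f ` slopes L u v w = R"
  proof
    have "f a \<noteq> vec.span {u, w}" for a
    proof
      assume "f a = vec.span {u, w}"
      moreover have "w \<in> vec.span {u, w}" by (rule vec.span_base) simp
      ultimately have "w \<in> vec.span {u, v + a *s w}" unfolding f_def by blast
      then show False using noncollinear_mem_span[OF nc, of 0 0 1 a] by simp
    qed
    then show "f ` slopes L u v w \<subseteq> R"
      by (auto simp: R_def slopes_def f_def vec.span_base)
    show "R \<subseteq> f ` slopes L u v w"
    proof
      fix l assume l: "l \<in> R"
      then have lL: "l \<in> L" "u \<in> l" "l \<noteq> vec.span {u, w}" by (auto simp: R_def)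
      then have "w \<notin> l" using proj_line_eq_span[OF line[OF lL(1)] lL(2) _ u0 wu] by blast
      then obtain a where a: "v + a *s w \<in> l" using proj_line_complement[OF line[OF lL(1)]] by metis
      have "v + a *s w \<notin> vec.span {u}"
        using noncollinear_notin_span[OF nc, of 1 a 0] by simp
      then have "l = f a" unfolding f_def using proj_line_eq_span[OF line[OF lL(1)] lL(2) a u0] by blast
      then show "l \<in> f ` slopes L u v w" using lL(1) by (auto simp: slopes_def f_def)
    qed
  qed
  show "finite (slopes L u v w)" using im inj finR by (metis finite_imageD)
  have "card R = card {l \<in> L. u \<in> l} - 1"
    unfolding R_def using uw fin by (intro card_Diff_singleton) (auto simp: vec.span_base)
  then show "card (slopes L u v w) = multiplicity_at L (vec.span {u}) - 1"
    using card_image[OF inj] im multiplicity_at_span[OF L] by metis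
qed

lemma modular_point_line:
  assumes "modular_point L (vec.span {u})" "crossing_point L (vec.span {v})" "v \<notin> vec.span {u}"
  shows "vec.span {u, v} \<in> L"
proof -
  have "vec.span {v} \<noteq> vec.span {u}" using assms(3) vec.span_base[of v "{v}"] by blast
  then show ?thesis using assms unfolding modular_point_def by (metis line_through_span)
qed

text \<open>The vector \<open>v\<close> witnesses that \<open>l\<close> and \<open>l'\<close>
  differ, which makes \<open>y\<close> a crossing point.\<close>

lemma modular_point_line_meet:
  assumes "line_arrangement L" "modular_point L (vec.span {u})"
    and "l \<in> L" "l' \<in> L" "y \<in> l" "y \<in> l'" "v \<in> l" "v \<notin> l'" "y \<notin> vec.span {u}"
  shows "vec.span {u, y} \<in> L"
  using assms unfolding modular_point_span[OF assms(1)] by blast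

section \<open>Three modular points: the collinear case and the triangle\<close>

text \<open>An injection between finite sets of equal size is a bijection, so the sum over
  \<open>C\<close> can be computed along \<open>a \<mapsto> b - a\<close>. The right-hand side is
  then independent of \<open>b\<close>.\<close>

lemma sum_image_diff:
  fixes b :: "'a::comm_ring_1"
  assumes "finite A" "finite C" "card A = card C" "\<And>a. a \<in> A \<Longrightarrow> b - a \<in> C"
  shows "of_nat (card A) * b = \<Sum>C + \<Sum>A"
proof -
  have inj: "inj_on (\<lambda>a. b - a) A" by (simp add: inj_on_def)
  moreover have "(\<lambda>a. b - a) ` A \<subseteq> C" using assms(4) by blast
  ultimately have "(\<lambda>a. b - a) ` A = C"
    using assms(2,3) by (metis card_image card_subset_eq)
  then have "\<Sum>C = (\<Sum>a\<in>A. b - a)" using inj by (metis sum.reindex_cong)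
  then show ?thesis by (simp add: sum_subtractf)
qed

text \<open>The multiplicative counterpart: the product over \<open>C\<close> is computed along the
  bijection \<open>a \<mapsto> 1 / (a * b)\<close>.\<close>

lemma prod_image_inverse_mult:
  fixes b :: "'a::field"
  assumes "finite A" "finite C" "card A = card C" "b \<noteq> 0" "0 \<notin> A"
    and "\<And>a. a \<in> A \<Longrightarrow> 1 / (a * b) \<in> C"
  shows "\<Prod>C * \<Prod>A * b ^ card A = 1"
proof -
  have inj: "inj_on (\<lambda>a. 1 / (a * b)) A"
  proof
    fix x y assume "x \<in> A" "y \<in> A" "1 / (x * b) = 1 / (y * b)"
    then show "x = y" using assms(4) by simp
  qed
  moreover have "(\<lambda>a. 1 / (a * b)) ` A \<subseteq> C" using assms(6) by blast
  ultimately have "(\<lambda>a. 1 / (a * b)) ` A = C"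
    using assms(2,3) by (metis card_image card_subset_eq)
  then have "\<Prod>C = (\<Prod>a\<in>A. 1 / (a * b))" using inj by (metis prod.reindex_cong)
  also have "\<dots> = 1 / (\<Prod>A * b ^ card A)" by (simp add: prod_dividef prod.distrib)
  finally show ?thesis using assms(1,4,5) by (auto simp: prod_zero_iff)
qed

lemma collinear_modular_points_sum:
  fixes u v :: "'a::field_char_0 ^ 3"
  assumes L: "line_arrangement L" and uv: "v \<notin> vec.span {u}"
    and mod: "modular_point L (vec.span {u})" "modular_point L (vec.span {v})"
      "modular_point L (vec.span {u + v})"
    and mult: "multiplicity_at L (vec.span {u}) = m" "multiplicity_at L (vec.span {v}) = m"
      "multiplicity_at L (vec.span {u + v}) = m"
  shows "m \<le> 2"
proof (rule ccontr)
  assume "\<not> m \<le> 2"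
  have u0: "u \<noteq> 0" using mod(1) crossing_point_span[OF L] by (auto simp: modular_point_def)
  define H where "H = vec.span {u, v}"
  have "proj_line H" unfolding H_def by (rule proj_line_span_pair[OF u0 uv])
  then have "H \<noteq> UNIV" using vec.dim_UNIV by (auto simp: proj_line_def vec.dimension_def card_cart_basis)
  then obtain w where "w \<notin> vec.span {u, v}" by (auto simp: H_def)
  then have nc: "noncollinear u v w" by (rule noncollinearI[OF u0 uv])
  have nc_u: "noncollinear u w v" using noncollinear_swap23[OF nc] .
  have nc_v: "noncollinear v w u" using noncollinear_rotate[OF nc] .
  have nc_uv: "noncollinear (u + v) w u"
    unfolding noncollinear_def
  proof (intro allI impI)
    fix a b c assume "a *s (u + v) + b *s w + c *s u = 0"
    then have "(a + c) *s u + a *s v + b *s w = 0 *s u + 0 *s v + 0 *s w"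
      by (simp add: vec_eq_iff algebra_simps)
    from noncollinear_coords_eq[OF nc this] show "a = 0 \<and> b = 0 \<and> c = 0" by simp
  qed
  have H: "vec.span {u, v} \<in> L"
    using mod uv by (intro modular_point_line) (auto simp: modular_point_def)
  then have H': "vec.span {v, u} \<in> L" by (simp add: insert_commute)
  have H'': "vec.span {u + v, u} \<in> L"
    using H span_pair_replace[of 1 u v 1] by (simp add: insert_commute add.commute)
  define A B C where "A = slopes L u w v" and "B = slopes L v w u" and "C = slopes L (u + v) w u"
  note card = slopes_finite_card[OF L nc_u H] slopes_finite_card[OF L nc_v H']
    slopes_finite_card[OF L nc_uv H'']
  have step: "b - a \<in> C" if a: "a \<in> A" and b: "b \<in> B" for a b
  proof -
    \<comment> \<open>The line of slope \<open>a\<close> through \<open>u\<close> meets the line of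
      slope \<open>b\<close> through \<open>v\<close> in \<open>y\<close>. Rewritten in terms of
      \<open>u + v\<close>, \<open>w\<close>, \<open>u\<close>, it shows slope \<open>b - a\<close>
      at the third point.\<close>
    define y where "y = b *s u + 1 *s w + a *s v"
    have "y \<in> vec.span {u, w + a *s v}"
      unfolding y_def noncollinear_mem_span[OF nc_u] by simp
    moreover have "y = a *s v + 1 *s w + b *s u" by (simp add: y_def ac_simps)
    then have "y \<in> vec.span {v, w + b *s u}" using noncollinear_mem_span[OF nc_v, of a 1 b b] by simp
    moreover have "u \<in> vec.span {u, w + a *s v}" by (rule vec.span_base) simp
    moreover have "u \<notin> vec.span {v, w + b *s u}" using noncollinear_mem_span[OF nc_v, of 0 0 1 b] by simp
    moreover have y: "y = a *s (u + v) + 1 *s w + (b - a) *s u"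
      by (simp add: y_def vec_eq_iff algebra_simps)
    then have "y \<notin> vec.span {u + v}" using noncollinear_notin_span[OF nc_uv, of 1 "b - a" a] by simp
    ultimately have "vec.span {u + v, y} \<in> L"
      using modular_point_line_meet[OF L mod(3)] a b by (auto simp: A_def B_def slopes_def)
    also have "y = 1 *s (w + (b - a) *s u) + a *s (u + v)" by (simp add: y ac_simps)
    also have "vec.span {u + v, \<dots>} = vec.span {u + v, w + (b - a) *s u}"
      by (rule span_pair_replace) simp
    finally show ?thesis by (simp add: C_def slopes_def)
  qed
  have "card B = m - 1" "finite B" using card mult by (auto simp: B_def)
  moreover have "m - 1 \<ge> 2" using \<open>\<not> m \<le> 2\<close> by simp
  ultimately obtain b b' where b: "b \<in> B" "b' \<in> B" "b \<noteq> b'"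
    using card_le_Suc0_iff_eq[of B] by (metis not_less_eq_eq numeral_2_eq_2)
  have "of_nat (card A) * c = \<Sum>C + \<Sum>A" if "c \<in> B" for c
    using sum_image_diff[of A C c] card mult step that by (simp add: A_def C_def)
  from this[OF b(1)] this[OF b(2)] have "of_nat (card A) * (b - b') = 0"
    by (simp add: algebra_simps)
  moreover have "card A \<noteq> 0" using card mult \<open>m - 1 \<ge> 2\<close> by (simp add: A_def)
  ultimately show False using b(3) by simp
qed

lemma modular_points_not_collinear:
  fixes u v x :: "'a::field_char_0 ^ 3"
  assumes L: "line_arrangement L"
    and mod: "modular_point L (vec.span {u})" "modular_point L (vec.span {v})"
      "modular_point L (vec.span {x})"
    and mult: "multiplicity_at L (vec.span {u}) = m" "multiplicity_at L (vec.span {v}) = m"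
      "multiplicity_at L (vec.span {x}) = m"
    and m: "m \<ge> 3"
    and neq: "vec.span {u} \<noteq> vec.span {v}" "vec.span {u} \<noteq> vec.span {x}" "vec.span {v} \<noteq> vec.span {x}"
  shows "noncollinear u v x"
proof -
  have nz: "u \<noteq> 0" "v \<noteq> 0" "x \<noteq> 0"
    using mod crossing_point_span[OF L] by (auto simp: modular_point_def)
  have uv: "v \<notin> vec.span {u}" and ux: "x \<notin> vec.span {u}" and vx: "x \<notin> vec.span {v}"
    using neq nz by (simp_all add: span_singleton_eq_iff)
  have "x \<notin> vec.span {u, v}"
  proof
    assume "x \<in> vec.span {u, v}"
    then obtain a b where x: "x = a *s u + b *s v" unfolding mem_span_pair by blast
    \<comment> \<open>The three points are distinct, so both coefficients are nonzero; absorbing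
      them into \<open>u\<close> and \<open>v\<close> turns \<open>x\<close> into a sum, as the
      collinear case requires.\<close>
    have a: "a \<noteq> 0" using vx x by (metis add_0 vec.scale_zero_left vec.span_base vec.span_scale singletonI)
    have b: "b \<noteq> 0" using ux x by (metis add.right_neutral vec.scale_zero_left vec.span_base vec.span_scale singletonI)
    have span: "vec.span {a *s u} = vec.span {u}" "vec.span {b *s v} = vec.span {v}"
      using span_singleton_scale a b by blast+
    have "b *s v \<notin> vec.span {a *s u}"
      using neq(1) nz a b span span_singleton_eq_iff[of "a *s u" "b *s v"] by simp
    then have "m \<le> 2"
      using collinear_modular_points_sum[OF L, of "b *s v" "a *s u" m] mod mult span x by simp
    then show False using m by simp
  qed
  then show ?thesis by (rule noncollinearI[OF nz(1) uv])
qed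

text \<open>By Ceva, concurrent lines through the three vertices, none of them a side, have slopes
  with product 1. So each nonzero slope \<open>c\<close> at \<open>v\<close> matches the nonzero
  slopes at \<open>u\<close> with those at \<open>w\<close>; multiplying over all of them fixes
  \<open>c ^ (m - 2)\<close>.\<close>

lemma triangle_slopes_power_eq:
  assumes L: "line_arrangement L" and nc: "noncollinear u v w"
    and mod: "modular_point L (vec.span {u})" "modular_point L (vec.span {v})"
      "modular_point L (vec.span {w})"
    and mult: "multiplicity_at L (vec.span {u}) = m" "multiplicity_at L (vec.span {w}) = m"
    and m: "m \<ge> 3"
    and b: "b \<in> slopes L v w u" "b' \<in> slopes L v w u" "b \<noteq> 0" "b' \<noteq> 0"
  shows "b ^ (m - 2) = b' ^ (m - 2)"
proof -
  have nc_v: "noncollinear v w u" and nc_w: "noncollinear w u v"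
    using noncollinear_rotate nc by blast+
  have sides: "vec.span {u, w} \<in> L" "vec.span {u, v} \<in> L" "vec.span {w, u} \<in> L" "vec.span {w, v} \<in> L"
  proof -
    have "v \<notin> vec.span {u}" using noncollinear_notin_span[OF nc, of 1 0 0] by simp
    moreover have "w \<notin> vec.span {u}" using noncollinear_notin_span[OF nc, of 0 1 0] by simp
    moreover have "u \<notin> vec.span {w}" using noncollinear_notin_span[OF nc_w, of 1 0 0] by simp
    moreover have "v \<notin> vec.span {w}" using noncollinear_notin_span[OF nc_w, of 0 1 0] by simp
    ultimately show "vec.span {u, w} \<in> L" "vec.span {u, v} \<in> L" "vec.span {w, u} \<in> L" "vec.span {w, v} \<in> L"
      using mod by (auto intro!: modular_point_line simp: modular_point_def)
  qed
  \<comment> \<open>Of the \<open>m\<close> lines through \<open>u\<close> or \<open>w\<close>, one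
    side of the triangle has no slope and the other has slope 0, which leaves \<open>m - 2\<close>
    nonzero slopes.\<close>
  define A C where "A = slopes L u v w - {0}" and "C = slopes L w u v - {0}"
  have zero: "0 \<in> slopes L u v w" "0 \<in> slopes L w u v" using sides by (auto simp: slopes_def)
  have A: "finite A" "card A = m - 2" and C: "finite C" "card C = m - 2"
    using slopes_finite_card[OF L nc sides(1)] slopes_finite_card[OF L nc_w sides(4)] mult zero
    by (simp_all add: A_def C_def)
  have step: "1 / (a * c) \<in> C" if a: "a \<in> A" and c: "c \<in> slopes L v w u" "c \<noteq> 0" for a c
  proof -
    have a0: "a \<noteq> 0" and aL: "vec.span {u, v + a *s w} \<in> L" using a by (auto simp: A_def slopes_def)
    have cL: "vec.span {v, w + c *s u} \<in> L" using c by (simp add: slopes_def)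
    \<comment> \<open>The line of slope \<open>a\<close> through \<open>u\<close> meets the line of
      slope \<open>c\<close> through \<open>v\<close> in \<open>y\<close>; dividing by the
      coefficient of \<open>u\<close> gives its slope as seen from \<open>w\<close>.\<close>
    define y where "y = (a * c) *s u + 1 *s v + a *s w"
    have "y \<in> vec.span {u, v + a *s w}"
      unfolding y_def noncollinear_mem_span[OF nc] by simp
    moreover have "y = 1 *s v + a *s w + (a * c) *s u" by (simp add: y_def ac_simps)
    then have "y \<in> vec.span {v, w + c *s u}"
      using noncollinear_mem_span[OF nc_v, of 1 a "a * c" c] by (simp add: mult.commute)
    moreover have "u \<in> vec.span {u, v + a *s w}" by (rule vec.span_base) simp
    moreover have "u \<notin> vec.span {v, w + c *s u}" using noncollinear_mem_span[OF nc_v, of 0 0 1 c] by simp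
    moreover have y: "y = a *s w + (a * c) *s u + 1 *s v" by (simp add: y_def ac_simps)
    then have "y \<notin> vec.span {w}" using noncollinear_notin_span[OF nc_w, of "a * c" 1 a] by simp
    ultimately have "vec.span {w, y} \<in> L"
      using modular_point_line_meet[OF L mod(3) aL cL] by blast
    also have "y = (a * c) *s (u + (1 / (a * c)) *s v) + a *s w"
      using a0 c(2) by (simp add: y_def vec_eq_iff algebra_simps)
    also have "vec.span {w, \<dots>} = vec.span {w, u + (1 / (a * c)) *s v}"
      by (rule span_pair_replace) (use a0 c(2) in simp)
    finally show ?thesis using a0 c(2) by (simp add: C_def slopes_def)
  qed
  have "\<Prod>C * \<Prod>A * c ^ (m - 2) = 1" if "c \<in> slopes L v w u" "c \<noteq> 0" for c
    using prod_image_inverse_mult[of A C c] A C step that by (simp add: A_def)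
  from this[OF b(1,3)] this[OF b(2,4)] show ?thesis
    by (metis mult_cancel_left mult_zero_left zero_neq_one)
qed

text \<open>Projection from \<open>v\<close> forgets the coordinate \<open>b\<close>, so the line
  from \<open>v\<close> to \<open>p\<close> has slope \<open>a / c\<close>.\<close>

lemma modular_point_slope:
  assumes L: "line_arrangement L" and nc: "noncollinear u v w"
    and mod: "modular_point L (vec.span {v})" and cross: "crossing_point L (vec.span {p})"
    and p: "p = a *s u + b *s v + c *s w" and c: "c \<noteq> 0"
  shows "a / c \<in> slopes L v w u"
proof -
  have nc_v: "noncollinear v w u" using noncollinear_rotate[OF nc] .
  have eq: "p = b *s v + c *s w + a *s u" by (simp add: p ac_simps)
  then have "p \<notin> vec.span {v}" using noncollinear_notin_span[OF nc_v, of c a b] c by simp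
  then have "vec.span {v, p} \<in> L" using modular_point_line[OF mod cross] by blast
  also have "p = c *s (w + (a / c) *s u) + b *s v"
    using c by (simp add: p vec_eq_iff field_simps)
  also have "vec.span {v, \<dots>} = vec.span {v, w + (a / c) *s u}"
    by (rule span_pair_replace[OF c])
  finally show ?thesis by (simp add: slopes_def)
qed

section \<open>Excluding five modular points\<close>

text \<open>Attached to a spanning vector instead of a point, so that representatives can be
  rescaled.\<close>

definition modular_vector :: "('a::field ^ 3) set set \<Rightarrow> nat \<Rightarrow> 'a ^ 3 \<Rightarrow> bool" where
  "modular_vector L m v \<longleftrightarrow>
    modular_point L (vec.span {v}) \<and> multiplicity_at L (vec.span {v}) = m"

lemma modular_vector_scale:
  "k \<noteq> 0 \<Longrightarrow> modular_vector L m (k *s v) \<longleftrightarrow> modular_vector L m v"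
  by (simp add: modular_vector_def span_singleton_scale)

text \<open>Both \<open>a / c\<close> and \<open>a' / c'\<close> are nonzero slopes at
  \<open>v\<close>, so their powers with the positive exponent \<open>m - 2\<close> agree, and hence
  their moduli. The conclusion is cross-multiplied to avoid quotients.\<close>

lemma modular_vectors_norm_eq:
  fixes u v w p q :: "complex ^ 3"
  assumes L: "line_arrangement L" and m: "m \<ge> 3" and nc: "noncollinear u v w"
    and mod: "modular_vector L m u" "modular_vector L m v" "modular_vector L m w"
      "modular_vector L m p" "modular_vector L m q"
    and p: "p = a *s u + b *s v + c *s w" and q: "q = a' *s u + b' *s v + c' *s w"
    and nz: "a \<noteq> 0" "c \<noteq> 0" "a' \<noteq> 0" "c' \<noteq> 0"
  shows "norm a * norm c' = norm a' * norm c"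
proof -
  have mod': "modular_point L (vec.span {u})" "modular_point L (vec.span {v})"
      "modular_point L (vec.span {w})" "crossing_point L (vec.span {p})" "crossing_point L (vec.span {q})"
    and mult: "multiplicity_at L (vec.span {u}) = m" "multiplicity_at L (vec.span {w}) = m"
    using mod by (auto simp: modular_vector_def modular_point_def)
  have "(a / c) ^ (m - 2) = (a' / c') ^ (m - 2)"
    using triangle_slopes_power_eq[OF L nc mod'(1-3) mult m
        modular_point_slope[OF L nc mod'(2,4) p nz(2)] modular_point_slope[OF L nc mod'(2,5) q nz(4)]] nz
    by simp
  then have "norm (a / c) ^ (m - 2) = norm (a' / c') ^ (m - 2)" by (metis norm_power)
  then have "norm (a / c) = norm (a' / c')"
    using m by (intro power_eq_imp_eq_base[of "norm (a / c)" "m - 2"]) auto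
  then show ?thesis using nz by (simp add: norm_divide field_simps)
qed

text \<open>After division by \<open>x\<close>, both \<open>s\<close> and \<open>t\<close> have
  distance 1 from 0 and from 1, which forces real part 1/2 and squared imaginary part 3/4. Distance
  1 between them would make the product of the imaginary parts 1/4, but its square is 9/16.\<close>

lemma no_regular_tetrahedron_in_plane:
  fixes x y z :: complex
  assumes nz: "x \<noteq> 0"
    and "norm y = norm x" "norm z = norm x"
      "norm (x - y) = norm x" "norm (x - z) = norm x" "norm (y - z) = norm x"
  shows False
proof -
  define s t where "s = y / x" and "t = z / x"
  have unit: "norm s = 1" "norm t = 1" using assms by (simp_all add: s_def t_def norm_divide)
  have "s - 1 = - ((x - y) / x)" "t - 1 = - ((x - z) / x)" "s - t = (y - z) / x"
    using nz by (simp_all add: s_def t_def field_simps)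
  then have diff: "norm (s - 1) = 1" "norm (t - 1) = 1" "norm (s - t) = 1"
    using assms by (simp_all only: norm_minus_cancel norm_divide) simp_all
  have sq: "(Re w)\<^sup>2 + (Im w)\<^sup>2 = 1" if "norm w = 1" for w
    using cmod_power2[of w] that by simp
  have s: "(Re s)\<^sup>2 + (Im s)\<^sup>2 = 1" and s1: "(Re s - 1)\<^sup>2 + (Im s)\<^sup>2 = 1"
    and t: "(Re t)\<^sup>2 + (Im t)\<^sup>2 = 1" and t1: "(Re t - 1)\<^sup>2 + (Im t)\<^sup>2 = 1"
    and st: "(Re s - Re t)\<^sup>2 + (Im s - Im t)\<^sup>2 = 1"
    using sq[OF unit(1)] sq[OF unit(2)] sq[OF diff(1)] sq[OF diff(2)] sq[OF diff(3)] by simp_all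
  have Re: "Re s = 1 / 2" "Re t = 1 / 2"
    using s s1 t t1 by (simp_all add: power2_eq_square algebra_simps)
  have Im: "(Im s)\<^sup>2 = 3 / 4" "(Im t)\<^sup>2 = 3 / 4"
    using s t by (simp_all add: Re power2_eq_square)
  then have "Im s * Im t = 1 / 4"
    using st by (simp add: Re power2_eq_square algebra_simps)
  then have "(Im s * Im t)\<^sup>2 = 1 / 16" by (simp only:) (simp add: power2_eq_square)
  then show False by (simp add: Im power_mult_distrib)
qed

lemma noncollinear_sum:
  assumes nc: "noncollinear u v w"
  shows "noncollinear u v (u + v + w)"
  unfolding noncollinear_def
proof (intro allI impI)
  fix a b c assume "a *s u + b *s v + c *s (u + v + w) = 0"
  then have "(a + c) *s u + (b + c) *s v + c *s w = 0 *s u + 0 *s v + 0 *s w"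
    by (simp add: vec_eq_iff algebra_simps)
  from noncollinear_coords_eq[OF nc this] show "a = 0 \<and> b = 0 \<and> c = 0" by simp
qed

text \<open>The conditions \<open>nz\<close> say that \<open>q\<close> lies on none of the six lines
  joining two of the other four points. The equalities of moduli come from the triangles
  \<open>u v w\<close>, \<open>u v p\<close> and \<open>u w p\<close>, where
  \<open>p = u + v + w\<close>; in each, \<open>q\<close> is compared with the remaining one of the
  four points.\<close>

lemma no_five_modular_vectors_normalized:
  fixes u v w q :: "complex ^ 3"
  assumes L: "line_arrangement L" and m: "m \<ge> 3" and nc: "noncollinear u v w"
    and mod: "modular_vector L m u" "modular_vector L m v" "modular_vector L m w"
      "modular_vector L m (u + v + w)" "modular_vector L m q"
    and q: "q = x *s u + y *s v + z *s w"
    and nz: "x \<noteq> 0" "y \<noteq> 0" "z \<noteq> 0" "x \<noteq> y" "x \<noteq> z" "y \<noteq> z"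
  shows False
proof -
  define p where "p = u + v + w"
  have p_mod: "modular_vector L m p" using mod(4) by (simp add: p_def)
  have nc_uvp: "noncollinear u v p" unfolding p_def using noncollinear_sum[OF nc] .
  have nc_uwp: "noncollinear u w p"
    unfolding p_def using noncollinear_sum[OF noncollinear_swap23[OF nc]] by (simp add: ac_simps)
  note norm_eq = modular_vectors_norm_eq[OF L m]
  have xz: "norm (1::complex) * norm z = norm x * norm (1::complex)"
    by (rule norm_eq[OF nc mod(1-3) p_mod mod(5), of 1 1 1 x y z])
      (use nz q in \<open>simp_all add: p_def\<close>)
  have xy: "norm (1::complex) * norm y = norm x * norm (1::complex)"
    by (rule norm_eq[OF noncollinear_swap23[OF nc] mod(1,3,2) p_mod mod(5), of 1 1 1 x z y])
      (use nz q in \<open>simp_all add: p_def ac_simps\<close>)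
  \<comment> \<open>Substituting \<open>w = p - u - v\<close>, or \<open>v = p - u - w\<close>,
    gives the coordinates of \<open>q\<close> in the new triangle; the replaced vertex gets the
    coordinates -1, -1, 1.\<close>
  have q_uvp: "q = (x - z) *s u + (y - z) *s v + z *s p"
    and q_uwp: "q = (x - y) *s u + (z - y) *s w + y *s p"
    by (simp_all add: p_def q vec_eq_iff algebra_simps)
  have "norm (- 1 :: complex) * norm z = norm (x - z) * norm (1::complex)"
    by (rule norm_eq[OF nc_uvp mod(1,2) p_mod mod(3,5) _ q_uvp, of "-1" "-1" 1])
      (use nz in \<open>simp_all add: p_def vec_eq_iff\<close>)
  moreover have "norm (- 1 :: complex) * norm z = norm (y - z) * norm (1::complex)"
    by (rule norm_eq[OF noncollinear_swap12[OF nc_uvp] mod(2,1) p_mod mod(3,5),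
          of "-1" "-1" 1 "y - z" "x - z" z])
      (use nz in \<open>simp_all add: p_def q vec_eq_iff algebra_simps\<close>)
  moreover have "norm (- 1 :: complex) * norm y = norm (x - y) * norm (1::complex)"
    by (rule norm_eq[OF nc_uwp mod(1,3) p_mod mod(2,5) _ q_uwp, of "-1" "-1" 1])
      (use nz in \<open>simp_all add: p_def vec_eq_iff\<close>)
  ultimately show False
    using no_regular_tetrahedron_in_plane[of x y z] xy xz nz by simp
qed

lemma noncollinear_not_combination:
  assumes "noncollinear u v w"
  shows "w \<noteq> a *s u + b *s v"
proof
  assume "w = a *s u + b *s v"
  then have "0 *s u + 0 *s v + 1 *s w = a *s u + b *s v + 0 *s w" by simp
  from noncollinear_coords_eq(3)[OF assms this] show False by simp
qed

lemma no_five_modular_vectors: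
  fixes v1 v2 v3 v4 v5 :: "complex ^ 3"
  assumes L: "line_arrangement L" and m: "m \<ge> 3"
    and mod: "modular_vector L m v1" "modular_vector L m v2" "modular_vector L m v3"
      "modular_vector L m v4" "modular_vector L m v5"
    and dist: "distinct [vec.span {v1}, vec.span {v2}, vec.span {v3}, vec.span {v4}, vec.span {v5}]"
  shows False
proof -
  have nc: "noncollinear x y z"
    if "modular_vector L m x" "modular_vector L m y" "modular_vector L m z"
      "vec.span {x} \<noteq> vec.span {y}" "vec.span {x} \<noteq> vec.span {z}" "vec.span {y} \<noteq> vec.span {z}"
    for x y z
    using modular_points_not_collinear[OF L, of x y z m] that m by (simp add: modular_vector_def)
  have nc123: "noncollinear v1 v2 v3" by (rule nc) (use mod dist in auto)
  obtain a b c where v4: "v4 = a *s v1 + b *s v2 + c *s v3" using noncollinear_coords[OF nc123] .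
  have "noncollinear v2 v3 v4" "noncollinear v1 v3 v4" "noncollinear v1 v2 v4"
    by (rule nc; use mod dist in auto)+
  then have "v4 \<noteq> b *s v2 + c *s v3" "v4 \<noteq> a *s v1 + c *s v3" "v4 \<noteq> a *s v1 + b *s v2"
    by (simp_all only: noncollinear_not_combination not_False_eq_True)
  then have a: "a \<noteq> 0" and b: "b \<noteq> 0" and c: "c \<noteq> 0" using v4 by auto
  \<comment> \<open>Absorbing the coefficients into the vertices gives the fourth point the
    coordinates 1, 1, 1.\<close>
  define u v w where "u = a *s v1" and "v = b *s v2" and "w = c *s v3"
  have span: "vec.span {u} = vec.span {v1}" "vec.span {v} = vec.span {v2}" "vec.span {w} = vec.span {v3}"
    using span_singleton_scale a b c by (simp_all add: u_def v_def w_def)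
  have mod': "modular_vector L m u" "modular_vector L m v" "modular_vector L m w"
    using mod a b c by (simp_all add: u_def v_def w_def modular_vector_scale)
  have p: "v4 = u + v + w" by (simp add: v4 u_def v_def w_def)
  have nc_uvw: "noncollinear u v w" by (rule nc) (use mod' dist span in auto)
  obtain x y z where q: "v5 = x *s u + y *s v + z *s w" using noncollinear_coords[OF nc_uvw] .
  have "noncollinear v w v5" "noncollinear u w v5" "noncollinear u v v5"
    "noncollinear w v4 v5" "noncollinear v v4 v5" "noncollinear u v4 v5"
    by (rule nc; use mod mod' dist span in auto)+
  then have "v5 \<noteq> y *s v + z *s w" "v5 \<noteq> x *s u + z *s w" "v5 \<noteq> x *s u + y *s v"
    "v5 \<noteq> (z - x) *s w + x *s v4" "v5 \<noteq> (y - x) *s v + x *s v4" "v5 \<noteq> (x - y) *s u + y *s v4"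
    by (simp_all only: noncollinear_not_combination not_False_eq_True)
  \<comment> \<open>Each equality of two coordinates would put \<open>v5\<close> on the line joining
    \<open>v4\<close> to the vertex of the third coordinate.\<close>
  moreover have "x = y \<Longrightarrow> v5 = (z - x) *s w + x *s v4" "x = z \<Longrightarrow> v5 = (y - x) *s v + x *s v4"
    "y = z \<Longrightarrow> v5 = (x - y) *s u + y *s v4"
    by (simp_all add: q p vec_eq_iff algebra_simps)
  ultimately have "x \<noteq> 0" "y \<noteq> 0" "z \<noteq> 0" "x \<noteq> y" "x \<noteq> z" "y \<noteq> z"
    using q by auto
  then show False
    using no_five_modular_vectors_normalized[OF L m nc_uvw mod' _ mod(5) q] mod(4) p by simp
qed

theorem theorem6:
  fixes m :: nat and \<L> :: "(complex ^ 3) set set"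
  assumes "m \<ge> 3"
    and "homogeneous_supersolvable m \<L>"
  shows "1 \<le> num_crossing_points \<L> m \<and> num_crossing_points \<L> m \<le> 4"
proof
  define P where "P = {p. crossing_point \<L> p \<and> multiplicity_at \<L> p = m}"
  have num: "num_crossing_points \<L> m = card P" by (simp add: num_crossing_points_def P_def)
  have L: "line_arrangement \<L>" and hom: "\<And>p. modular_point \<L> p \<Longrightarrow> multiplicity_at \<L> p = m"
    and "\<exists>p. modular_point \<L> p"
    using assms(2) by (auto simp: homogeneous_supersolvable_def supersolvable_def)
  then obtain p where p: "modular_point \<L> p" by blast
  then obtain u where u: "p = vec.span {u}"
    by (auto simp: modular_point_def crossing_point_def proj_point_iff)
  have "p \<in> P" using p hom by (simp add: P_def modular_point_def)
  \<comment> \<open>An infinite set has \<open>card\<close> 0, so the lower bound needs finiteness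
    as well as an element.\<close>
  moreover have "finite P"
    by (rule finite_subset[OF _ finite_crossing_points[OF L]]) (auto simp: P_def)
  ultimately show "1 \<le> num_crossing_points \<L> m"
    unfolding num by (metis card_0_eq empty_iff less_one not_less)
  have vec: "\<exists>v. p' = vec.span {v} \<and> modular_vector \<L> m v" if pP: "p' \<in> P" for p'
  proof -
    obtain v where v: "p' = vec.span {v}"
      using pP unfolding P_def crossing_point_def proj_point_iff by blast
    \<comment> \<open>Homogeneity gives the known modular point \<open>p\<close> multiplicity
      \<open>m\<close> too, so modularity passes from \<open>p\<close> to every point of
      \<open>P\<close>.\<close>
    have "modular_point \<L> (vec.span {v})"
      using modular_point_if_same_multiplicity[OF L p[unfolded u], of v] pP v hom[OF p] u
      by (simp add: P_def)
    then show ?thesis using v hom by (auto simp: modular_vector_def)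
  qed
  show "num_crossing_points \<L> m \<le> 4"
  proof (rule ccontr)
    assume "\<not> num_crossing_points \<L> m \<le> 4"
    then have "5 \<le> card P" by (simp add: num)
    then obtain Q where Q: "Q \<subseteq> P" "card Q = 5" "finite Q" by (rule obtain_subset_with_card_n)
    then obtain ps where ps: "set ps = Q" "distinct ps" using finite_distinct_list by blast
    then have "length ps = 5" using Q by (metis distinct_card)
    then obtain p1 p2 p3 p4 p5 where list: "ps = [p1, p2, p3, p4, p5]"
      by (auto simp: numeral_eq_Suc length_Suc_conv)
    have "set ps \<subseteq> P" using ps(1) Q(1) by simp
    then have P5: "p1 \<in> P" "p2 \<in> P" "p3 \<in> P" "p4 \<in> P" "p5 \<in> P" unfolding list by simp_all
    obtain g where g: "\<And>p'. p' \<in> P \<Longrightarrow> p' = vec.span {g p'} \<and> modular_vector \<L> m (g p')"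
      using vec by metis
    have span: "vec.span {g p'} = p'" and mod: "modular_vector \<L> m (g p')" if "p' \<in> P" for p'
      using g[OF that] by simp_all
    show False
      using no_five_modular_vectors[OF L assms(1) P5[THEN mod]] ps(2) list P5 by (simp add: span)
  qed
qed

end
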